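(* Let $\Gamma$ be a countable group and let $Z\subset\mathrm{Sub}(\Gamma)$ be a uniformly recurrent subgroup. Suppose that there exists a Borel $(\Gamma,Z)$-action $\alpha:\Gamma\curvearrowright X$ on a standard Borel space $X$ that admits an invariant probability measure. Then there exists a continuous $(\Gamma,Z)$-action $\beta:\Gamma\curvearrowright\mathcal{C}$ on the Cantor set $\mathcal{C}$ admitting an invariant probability measure such that the map $\mathrm{Stab}_\beta:\mathcal{C}\to\mathrm{Sub}(\Gamma)$ is continuous everywhere and $\mathrm{Stab}_\beta(\mathcal{C})=Z$.
   Context: $\mathcal{C}=\{0,1\}^{\mathbb{N}}$ is the Cantor set. $\mathrm{Sub}(\Gamma)$ is the compact metrizable space of all subgroups of $\Gamma$, with the topology induced from $\{0,1\}^\Gamma$; $\Gamma$ acts on it continuously by conjugation, $(\delta,H)\mapsto \delta H\delta^{-1}$. A uniformly recurrent subgroup of $\Gamma$ is a nonempty minimal closed conjugation-invariant subset $Z\subset\mathrm{Sub}(\Gamma)$. For an action $\beta:\Gamma\curvearrowright M$, the map $\mathrm{Stab}_\beta:M\to\mathrm{Sub}(\Gamma)$ sends $x$ to its stabilizer $\{\gamma\in\Gamma:\beta(\gamma)(x)=x\}$. A $(\Gamma,Z)$-action is an action $\beta:\Gamma\curvearrowright M$ such that $\mathrm{Stab}_\beta(x)\in Z$ for every $x\in M$. Borel actions are by Borel automorphisms, continuous actions are by homeomorphisms, and probability measures are Borel probability measures. *)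

theory Defs
  imports "HOL-Probability.Probability" "HOL-Algebra.Group_Action"
begin

(* Pulling back the product topology along H |-> indicator of H embeds Sub(G) in {0,1}^G. *)
definition subgroup_space :: "('a, 'm) monoid_scheme \<Rightarrow> 'a set topology" where
  "subgroup_space G =
     pullback_topology {H. subgroup H G} (\<lambda>H. \<lambda>g\<in>carrier G. g \<in> H)
       (product_topology (\<lambda>_. discrete_topology (UNIV :: bool set)) (carrier G))"

definition conjugate_set :: "('a, 'm) monoid_scheme \<Rightarrow> 'a \<Rightarrow> 'a set \<Rightarrow> 'a set" where
  "conjugate_set G g H = g <#\<^bsub>G\<^esub> H #>\<^bsub>G\<^esub> inv\<^bsub>G\<^esub> g"

definition conj_invariant :: "('a, 'm) monoid_scheme \<Rightarrow> 'a set set \<Rightarrow> bool" where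
  "conj_invariant G Z \<longleftrightarrow> (\<forall>g\<in>carrier G. \<forall>H\<in>Z. conjugate_set G g H \<in> Z)"

definition uniformly_recurrent_subgroup ::
    "('a, 'm) monoid_scheme \<Rightarrow> 'a set set \<Rightarrow> bool" where
  "uniformly_recurrent_subgroup G Z \<longleftrightarrow>
     Z \<noteq> {} \<and> closedin (subgroup_space G) Z \<and> conj_invariant G Z \<and>
     (\<forall>Y. Y \<noteq> {} \<and> Y \<subseteq> Z \<and> closedin (subgroup_space G) Y \<and> conj_invariant G Y \<longrightarrow> Y = Z)"

definition borel_of :: "'x topology \<Rightarrow> 'x measure" where
  "borel_of T = sigma (topspace T) {U. openin T U}"

(* The measure carried by X is irrelevant: X stands for the measurable space (space X, sets X). *)
definition standard_borel :: "'x measure \<Rightarrow> bool" where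
  "standard_borel X \<longleftrightarrow>
     (\<exists>T. completely_metrizable_space T \<and> second_countable T \<and>
          space X = topspace T \<and> sets X = sets (borel_of T))"

definition cantor_space :: "(nat \<Rightarrow> bool) topology" where
  "cantor_space = product_topology (\<lambda>_. discrete_topology UNIV) UNIV"

(* The inverse of \<alpha> g is \<alpha> (inv g), so each \<alpha> g is an automorphism of the measurable space. *)
definition borel_action ::
    "('a, 'm) monoid_scheme \<Rightarrow> 'x measure \<Rightarrow> ('a \<Rightarrow> 'x \<Rightarrow> 'x) \<Rightarrow> bool" where
  "borel_action G X \<alpha> \<longleftrightarrow>
     group_action G (space X) \<alpha> \<and> (\<forall>g\<in>carrier G. \<alpha> g \<in> X \<rightarrow>\<^sub>M X)"

definition continuous_action ::
    "('a, 'm) monoid_scheme \<Rightarrow> 'x topology \<Rightarrow> ('a \<Rightarrow> 'x \<Rightarrow> 'x) \<Rightarrow> bool" where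
  "continuous_action G T \<beta> \<longleftrightarrow>
     group_action G (topspace T) \<beta> \<and> (\<forall>g\<in>carrier G. homeomorphic_map T T (\<beta> g))"

definition stabilizers_in ::
    "('a, 'm) monoid_scheme \<Rightarrow> 'a set set \<Rightarrow> 'x set \<Rightarrow> ('a \<Rightarrow> 'x \<Rightarrow> 'x) \<Rightarrow> bool" where
  "stabilizers_in G Z M \<beta> \<longleftrightarrow> (\<forall>x\<in>M. stabilizer G \<beta> x \<in> Z)"

definition admits_invariant_probability ::
    "('a, 'm) monoid_scheme \<Rightarrow> 'x measure \<Rightarrow> ('a \<Rightarrow> 'x \<Rightarrow> 'x) \<Rightarrow> bool" where
  "admits_invariant_probability G X \<alpha> \<longleftrightarrow>
     (\<exists>\<mu>. prob_space \<mu> \<and> sets \<mu> = sets X \<and> (\<forall>g\<in>carrier G. distr \<mu> X (\<alpha> g) = \<mu>))"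

end

theory Submission
  imports Defs
begin

text \<open>Write \<open>C\<close> for the space of binary sequences. The idea is to code the points of \<open>X\<close> by
  binary sequences in such a way that all that matters about the action is expressed by closed
  conditions on the codes, and so survives passing to the closure of the set of codes.

  For a single group element \<open>g\<close>, the graph on \<open>X\<close> joining \<open>x\<close> to \<open>\<alpha> g x\<close> whenever these differ has
  degree at most two, so a greedy procedure along a countable separating family of Borel sets colours
  it properly with finitely many colours in a Borel way (\<open>finite_measurable_colouring\<close>). Record for
  each \<open>x\<close> the colours, for all \<open>g\<close>, of all its translates \<open>\<alpha> d x\<close>. This gives a Borel equivariant map
  from \<open>X\<close> into a shift space. If \<open>\<alpha> g x = x\<close>, then the shift by \<open>g\<close> fixes the code of \<open>x\<close>; if not,
  then the \<open>g\<close>-colours recorded at the identity and at \<open>g\<close> differ. Because there are only finitely many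
  colours, which alternative holds is decided by finitely many coordinates. Both implications
  therefore hold for every point of the closure, where the set of fixed points of the shift by \<open>g\<close>
  is consequently clopen (\<open>shift_code_fixes_iff\<close>). Clopen fixed point sets for all \<open>g\<close> amount to a
  continuous stabilizer map, and as the stabilizers of the codes lie in the closed set \<open>Z\<close>, so do
  all others.

  The closure may have isolated points. Interleaving each code with an arbitrary binary
  sequence, on which the group acts trivially, removes them without changing stabilizers. What
  results is a nonempty closed perfect subset of \<open>C\<close>, and such a set is homeomorphic to \<open>C\<close> by
  reading off a sequence only at the places where the set branches
  (\<open>perfect_closed_homeomorphic_cantor\<close>). Transporting the shift along this homeomorphism gives
  \<open>\<beta>\<close> (\<open>cantor_model\<close>).

  The invariant measure is pushed forward along the equivariant coding map, with the auxiliary sequence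
  held constant. Finally, the image of the stabilizer map is nonempty, compact and
  conjugation invariant inside \<open>Z\<close>, hence equal to \<open>Z\<close> by minimality (\<open>stabilizer_image_eq_urs\<close>).\<close>

section \<open>The topology of binary sequences\<close>

lemma cantor_space_eq_euclidean: "cantor_space = euclidean"
proof -
  have "discrete_topology UNIV = (euclidean :: bool topology)"
    by (auto simp: topology_eq intro: Topological_Spaces.open_discrete)
  then show ?thesis by (simp add: cantor_space_def euclidean_product_topology)
qed

lemma borel_of_cantor_space: "borel_of cantor_space = borel"
  by (simp add: borel_of_def cantor_space_eq_euclidean borel_def)

lemma compact_cantor_space: "compact (UNIV :: (nat \<Rightarrow> bool) set)"
proof -
  have "compact_space cantor_space"
    unfolding cantor_space_def by (simp add: compact_space_product_topology compact_space_discrete_topology)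
  then show ?thesis
    by (simp add: cantor_space_eq_euclidean compact_space_def)
qed

lemma open_coordinate_vimage:
  assumes "open W"
  shows "open ((\<lambda>f :: 'a \<Rightarrow> 'b::topological_space. f i) -` W)"
  using assms by (rule open_vimage) simp

text \<open>
  Distinct functions differ at some coordinate, and open sets separating the two values there pull
  back to open sets separating the functions. The three separation axioms are treated in increasing
  strength because an instance of a class presupposes instances, of at least the same
  generality, of its superclasses.
\<close>
instance "fun" :: (type, t0_space) t0_space
proof
  fix f g :: "'a \<Rightarrow> 'b"
  assume "f \<noteq> g"
  then obtain i where "f i \<noteq> g i" by blast
  then obtain U where "open U" "\<not> (f i \<in> U \<longleftrightarrow> g i \<in> U)"
    using t0_space_class.t0_space by blast
  then show "\<exists>U. open U \<and> \<not> (f \<in> U \<longleftrightarrow> g \<in> U)"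
    by (intro exI[of _ "(\<lambda>h. h i) -` U"]) (simp add: open_coordinate_vimage)
qed

instance "fun" :: (type, t1_space) t1_space
proof
  fix f g :: "'a \<Rightarrow> 'b"
  assume "f \<noteq> g"
  then obtain i where "f i \<noteq> g i" by blast
  then obtain U where "open U" "f i \<in> U" "g i \<notin> U"
    using t1_space_class.t1_space by blast
  then show "\<exists>U. open U \<and> f \<in> U \<and> g \<notin> U"
    by (intro exI[of _ "(\<lambda>h. h i) -` U"]) (simp add: open_coordinate_vimage)
qed

instance "fun" :: (type, t2_space) t2_space
proof
  fix f g :: "'a \<Rightarrow> 'b"
  assume "f \<noteq> g"
  then obtain i where "f i \<noteq> g i" by blast
  then obtain U V where "open U" "open V" "f i \<in> U" "g i \<in> V" "U \<inter> V = {}"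
    using hausdorff[of "f i" "g i"] by blast
  then show "\<exists>U V. open U \<and> open V \<and> f \<in> U \<and> g \<in> V \<and> U \<inter> V = {}"
    by (intro exI[of _ "(\<lambda>h. h i) -` U"] exI[of _ "(\<lambda>h. h i) -` V"])
       (simp add: open_coordinate_vimage vimage_Int[symmetric])
qed

instance bool :: second_countable_topology
proof
  have "open = generate_topology (UNIV :: bool set set)"
    by (rule ext) (simp add: Topological_Spaces.open_discrete generate_topology.Basis)
  then show "\<exists>B :: bool set set. countable B \<and> open = generate_topology B"
    by (intro exI[of _ UNIV]) (simp add: countable_finite)
qed

lemma open_coordinates_agree: "open {y :: nat \<Rightarrow> bool. y a = y b}"
proof -
  have "{y :: nat \<Rightarrow> bool. y a = y b} =
      ((\<lambda>y. y a) -` {True} \<inter> (\<lambda>y. y b) -` {True}) \<union>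
      ((\<lambda>y. y a) -` {False} \<inter> (\<lambda>y. y b) -` {False})"
    by auto
  then show ?thesis
    by (simp only:) (intro open_Un open_Int open_coordinate_vimage Topological_Spaces.open_discrete)
qed

lemma open_cylinder: "open {y :: nat \<Rightarrow> bool. \<forall>m<n. y m = x m}"
proof -
  have eq: "{y. \<forall>m<n. y m = x m} = (\<Inter>m\<in>{..<n}. (\<lambda>y. y m) -` {x m})" by auto
  have "open ((\<lambda>y :: nat \<Rightarrow> bool. y m) -` {x m})" for m
    by (rule open_vimage) (simp_all add: Topological_Spaces.open_discrete)
  then show ?thesis unfolding eq by (intro open_INT) auto
qed

text \<open>
  A basic open set of the product topology restricts finitely many coordinates, so it
  contains the cylinder given by any prefix that is longer than all of them.
\<close>
lemma open_contains_cylinder: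
  fixes z :: "nat \<Rightarrow> bool"
  assumes "open U" "z \<in> U"
  obtains n where "{y. \<forall>m<n. y m = z m} \<subseteq> U"
proof -
  obtain X where X: "z \<in> Pi\<^sub>E UNIV X" "finite {i. X i \<noteq> UNIV}" "Pi\<^sub>E UNIV X \<subseteq> U"
    using product_topology_open_contains_basis[of "\<lambda>_. euclidean" UNIV U z] assms
    by (auto simp: open_fun_def)
  define n where "n = Suc (Max (insert 0 {i. X i \<noteq> UNIV}))"
  have small: "i < n" if "X i \<noteq> UNIV" for i
  proof -
    have "i \<le> Max (insert 0 {i. X i \<noteq> UNIV})"
      using X(2) that by (intro Max_ge finite.insertI insertI2 CollectI)
    then show ?thesis unfolding n_def by (rule le_imp_less_Suc)
  qed
  have box: "y \<in> Pi\<^sub>E UNIV X" if y: "\<forall>m<n. y m = z m" for y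
  proof (rule PiE_I)
    fix i
    show "y i \<in> X i"
    proof (cases "X i = UNIV")
      case False
      then show ?thesis using small[OF False] y PiE_mem[OF X(1) UNIV_I, of i] by simp
    qed simp
  qed simp
  then have "{y. \<forall>m<n. y m = z m} \<subseteq> U"
    by (intro subsetI subsetD[OF X(3)] box) (erule CollectD)
  then show thesis by (rule that)
qed

text \<open>
  The principle by which identities between shifts pass from codes to limits of codes.
\<close>
lemma closure_subset_eqlocus:
  fixes f f' :: "'b::topological_space \<Rightarrow> 'c::t2_space"
  assumes "continuous_on UNIV f" "continuous_on UNIV f'" "\<And>y. y \<in> R \<Longrightarrow> f y = f' y" "y \<in> closure R"
  shows "f y = f' y"
proof -
  have "closure R \<subseteq> {y. f y = f' y}"
    using closed_Collect_eq[OF assms(1,2)] assms(3) by (intro closure_minimal) auto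
  then show ?thesis using assms(4) by blast
qed

section \<open>Perfect closed sets of binary sequences\<close>

text \<open>
  The levels at which the tree of prefixes of \<open>P\<close> branches along the path \<open>x\<close>.
\<close>
definition splits :: "(nat \<Rightarrow> bool) set \<Rightarrow> (nat \<Rightarrow> bool) \<Rightarrow> nat set" where
  "splits P x = {n. \<exists>y\<in>P. (\<forall>m<n. y m = x m) \<and> y n \<noteq> x n}"

text \<open>
  The subsequence of \<open>x\<close> consisting of the genuine choices made along \<open>x\<close>; between two
  branching levels the values of \<open>x\<close> are forced by \<open>P\<close>.
\<close>
definition branch_values :: "(nat \<Rightarrow> bool) set \<Rightarrow> (nat \<Rightarrow> bool) \<Rightarrow> nat \<Rightarrow> bool" where
  "branch_values P x k = x (enumerate (splits P x) k)"

text \<open>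
  Whether \<open>P\<close> branches at level \<open>n\<close> depends on the prefix of length \<open>n\<close> alone. This includes the
  level \<open>n\<close> itself: if the two sequences part there, then each witnesses branching for the other.
\<close>
lemma splits_cong:
  assumes "x \<in> P" "y \<in> P" "\<And>m. m < n \<Longrightarrow> x m = y m" "m \<le> n"
  shows "m \<in> splits P x \<longleftrightarrow> m \<in> splits P y"
proof (cases "x m = y m")
  case True
  then show ?thesis using assms(3,4) by (simp add: splits_def)
next
  case False
  then have "\<forall>k<m. y k = x k" "\<forall>k<m. x k = y k"
    using assms(3,4) by simp_all
  then have "m \<in> splits P x" "m \<in> splits P y"
    unfolding splits_def using False assms(1,2) by blast+
  then show ?thesis by simp
qed

lemma enumerate_cong:
  fixes S R :: "nat set"
  assumes "infinite S" "infinite R" "\<And>m. m \<le> enumerate S k \<Longrightarrow> m \<in> S \<longleftrightarrow> m \<in> R"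
  shows "enumerate R k = enumerate S k"
  using assms(3)
proof (induction k)
  case 0
  have S0: "enumerate S 0 \<in> S" using assms(1) by (rule enumerate_in_set)
  show ?case
    unfolding enumerate_0[of R]
  proof (rule Least_equality)
    show "enumerate S 0 \<in> R" using 0 S0 by simp
    fix s assume "s \<in> R"
    show "enumerate S 0 \<le> s"
    proof (rule ccontr)
      assume "\<not> enumerate S 0 \<le> s"
      then have "s < enumerate S 0" "s \<in> S" using 0[of s] \<open>s \<in> R\<close> by auto
      then show False unfolding enumerate_0 using not_less_Least by blast
    qed
  qed
next
  case (Suc k)
  have lt: "enumerate S k < enumerate S (Suc k)" using assms(1) by (rule enumerate_step)
  then have eq: "enumerate R k = enumerate S k" using Suc by simp
  have "(LEAST s. s \<in> R \<and> enumerate R k < s) = enumerate S (Suc k)"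
  proof (rule Least_equality)
    show "enumerate S (Suc k) \<in> R \<and> enumerate R k < enumerate S (Suc k)"
      using Suc.prems[of "enumerate S (Suc k)"] enumerate_in_set[OF assms(1)] lt eq by simp
    fix s assume s: "s \<in> R \<and> enumerate R k < s"
    show "enumerate S (Suc k) \<le> s"
    proof (rule ccontr)
      assume "\<not> enumerate S (Suc k) \<le> s"
      then have "s \<in> S \<and> enumerate S k < s" "s < enumerate S (Suc k)" using s eq Suc.prems[of s] by auto
      then show False
        unfolding enumerate_Suc''[OF assms(1)] using not_less_Least by blast
    qed
  qed
  then show ?case by (simp only: enumerate_Suc''[OF assms(2)])
qed

context
  fixes P :: "(nat \<Rightarrow> bool) set"
  assumes perfect: "\<And>x n. x \<in> P \<Longrightarrow> \<exists>y\<in>P. y \<noteq> x \<and> (\<forall>m<n. y m = x m)"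
begin

lemma infinite_splits:
  assumes "x \<in> P"
  shows "infinite (splits P x)"
  unfolding infinite_nat_iff_unbounded_le
proof
  fix n
  obtain y where y: "y \<in> P" "y \<noteq> x" "\<forall>m<n. y m = x m" using perfect[OF assms] by blast
  then obtain i where i: "y i \<noteq> x i" by blast
  define d where "d = (LEAST i. y i \<noteq> x i)"
  have "y d \<noteq> x d" unfolding d_def using i by (rule LeastI)
  moreover have "\<forall>m<d. y m = x m" unfolding d_def using not_less_Least by blast
  ultimately have "d \<in> splits P x" "n \<le> d"
    using y(1,3) by (auto simp: splits_def not_less[symmetric])
  then show "\<exists>m\<ge>n. m \<in> splits P x" by blast
qed

lemma enumerate_splits_cong:
  assumes "x \<in> P" "y \<in> P" "\<And>m. m < enumerate (splits P x) k \<Longrightarrow> x m = y m"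
  shows "enumerate (splits P y) k = enumerate (splits P x) k"
  using assms by (intro enumerate_cong infinite_splits splits_cong)

lemma continuous_on_branch_values: "continuous_on P (branch_values P)"
proof (rule continuous_on_coordinatewise_then_product)
  fix k
  show "continuous_on P (\<lambda>x. branch_values P x k)"
    unfolding continuous_on_topological
  proof (intro ballI allI impI)
    fix x B assume x: "x \<in> P" and B: "branch_values P x k \<in> B"
    let ?N = "enumerate (splits P x) k"
    have "branch_values P y k = branch_values P x k" if "y \<in> P" "\<forall>m<Suc ?N. y m = x m" for y
      using enumerate_splits_cong[OF x that(1), of k] that(2) by (simp add: branch_values_def)
    then show "\<exists>A. open A \<and> x \<in> A \<and> (\<forall>y\<in>P. y \<in> A \<longrightarrow> branch_values P y k \<in> B)"
      using B open_cylinder[of "Suc ?N" x]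
      by (intro exI[of _ "{y. \<forall>m<Suc ?N. y m = x m}"]) auto
  qed
qed

lemma inj_on_branch_values: "inj_on (branch_values P) P"
proof (rule inj_onI, rule ccontr)
  fix x y assume x: "x \<in> P" and y: "y \<in> P" and eq: "branch_values P x = branch_values P y"
    and "x \<noteq> y"
  then obtain i where i: "y i \<noteq> x i" by blast
  define d where "d = (LEAST i. y i \<noteq> x i)"
  have d: "y d \<noteq> x d" unfolding d_def using i by (rule LeastI)
  have agree: "\<forall>m<d. y m = x m" unfolding d_def using not_less_Least by blast
  have "d \<in> splits P x" unfolding splits_def using d agree y by blast
  then obtain k where k: "enumerate (splits P x) k = d"
    using enumerate_Ex[OF infinite_splits[OF x]] by blast
  then have "enumerate (splits P y) k = d"
    using enumerate_splits_cong[OF x y, of k] agree by simp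
  then show False using fun_cong[OF eq, of k] d k by (simp add: branch_values_def)
qed

text \<open>
  Density of the image. If the \<open>K\<close>-th choice along \<open>x\<close> is not the desired one, branching provides a
  point of \<open>P\<close> with the opposite choice at that level; it agrees with \<open>x\<close> below, so the earlier branching
  levels and choices are kept.
\<close>
lemma branch_values_prefix:
  assumes "P \<noteq> {}"
  shows "\<exists>x\<in>P. \<forall>k<K. branch_values P x k = z k"
proof (induction K)
  case 0
  then show ?case using assms by auto
next
  case (Suc K)
  then obtain x where x: "x \<in> P" "\<forall>k<K. branch_values P x k = z k" by blast
  let ?n = "enumerate (splits P x) K"
  show ?case
  proof (cases "x ?n = z K")
    case True
    then have "\<forall>k<Suc K. branch_values P x k = z k"
      using x(2) by (auto simp: less_Suc_eq branch_values_def)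
    then show ?thesis using x(1) by blast
  next
    case False
    have "?n \<in> splits P x" using infinite_splits[OF x(1)] by (rule enumerate_in_set)
    then obtain y where y: "y \<in> P" "\<forall>m<?n. y m = x m" "y ?n \<noteq> x ?n"
      by (auto simp: splits_def)
    have "branch_values P y k = z k" if "k < Suc K" for k
    proof -
      have le: "enumerate (splits P x) k \<le> ?n"
        using that infinite_splits[OF x(1)] by simp
      have eq: "enumerate (splits P y) k = enumerate (splits P x) k"
        using enumerate_splits_cong[OF x(1) y(1)] y(2) le by simp
      show ?thesis
      proof (cases "k = K")
        case True
        then show ?thesis using eq y(3) False by (auto simp: branch_values_def)
      next
        case False
        then have "k < K" using that by simp
        then have "enumerate (splits P x) k < ?n"
          using infinite_splits[OF x(1)] by simp
        then show ?thesis using x(2) \<open>k < K\<close> eq y(2) by (auto simp: branch_values_def)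
      qed
    qed
    then show ?thesis using y(1) by blast
  qed
qed

text \<open>
  The branch values are continuous and injective on the compact set \<open>P\<close>, so it suffices that they
  exhaust all sequences; since their image is closed, this follows from density.
\<close>
theorem perfect_closed_homeomorphic_cantor:
  assumes "closed P" "P \<noteq> {}"
  obtains h k :: "(nat \<Rightarrow> bool) \<Rightarrow> nat \<Rightarrow> bool" where "homeomorphism P UNIV h k"
proof -
  have "compact P"
    using compact_Int_closed[OF compact_cantor_space assms(1)] by simp
  have "z \<in> branch_values P ` P" for z
  proof -
    have "compact (branch_values P ` P)"
      by (rule compact_continuous_image) (rule continuous_on_branch_values \<open>compact P\<close>)+
    then have closed: "closed (branch_values P ` P)" by (rule compact_imp_closed)
    show "z \<in> branch_values P ` P"
    proof (rule ccontr)
      assume "z \<notin> branch_values P ` P"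
      then have "z \<in> - (branch_values P ` P)" by simp
      with closed obtain n where n: "{y. \<forall>m<n. y m = z m} \<subseteq> - (branch_values P ` P)"
        using open_contains_cylinder[OF open_Compl] by blast
      obtain x where x: "x \<in> P" "\<forall>k<n. branch_values P x k = z k"
        using branch_values_prefix[OF assms(2)] by blast
      have "branch_values P x \<in> - (branch_values P ` P)"
        by (rule subsetD[OF n], rule CollectI, rule x(2))
      then show False using x(1) by blast
    qed
  qed
  then have "branch_values P ` P = UNIV" by auto
  then have "\<exists>k. homeomorphism P UNIV (branch_values P) k"
    by (intro homeomorphism_compact \<open>compact P\<close> continuous_on_branch_values inj_on_branch_values)
  then obtain k where "homeomorphism P UNIV (branch_values P) k" by (rule exE)
  then show thesis by (rule that)
qed

end

section \<open>Finite Borel colourings\<close>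

text \<open>
  The value 3 means \<open>not yet coloured\<close>; the proper colours are 0, 1 and 2, which leave one to spare
  because each point has only the two neighbours \<open>T x\<close> and \<open>T' x\<close>. At stage \<open>n\<close> the points of \<open>A n\<close>
  are coloured simultaneously, which is harmless as long as \<open>A n\<close> contains no two neighbours.
\<close>
fun greedy_colour :: "('x \<Rightarrow> 'x) \<Rightarrow> ('x \<Rightarrow> 'x) \<Rightarrow> (nat \<Rightarrow> 'x set) \<Rightarrow> nat \<Rightarrow> 'x \<Rightarrow> nat" where
  "greedy_colour T T' A 0 x = 3"
| "greedy_colour T T' A (Suc n) x =
     (if greedy_colour T T' A n x = 3 \<and> x \<in> A n
      then LEAST j. j \<noteq> greedy_colour T T' A n (T x) \<and> j \<noteq> greedy_colour T T' A n (T' x)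
      else greedy_colour T T' A n x)"

lemma Least_avoiding_two:
  fixes a b :: nat
  defines "l \<equiv> LEAST j. j \<noteq> a \<and> j \<noteq> b"
  shows "l \<noteq> a" "l \<noteq> b" "l < 3"
proof -
  obtain j :: nat where j: "j \<noteq> a \<and> j \<noteq> b" "j < 3"
  proof (cases "0 \<noteq> a \<and> 0 \<noteq> b")
    case False
    show thesis
    proof (cases "1 \<noteq> a \<and> 1 \<noteq> b")
      case True then show thesis using that[of 1] by simp
    next
      case False
      then show thesis using \<open>\<not> (0 \<noteq> a \<and> 0 \<noteq> b)\<close> that[of 2] by auto
    qed
  qed (use that[of 0] in simp)
  show "l \<noteq> a" "l \<noteq> b"
    using LeastI[of "\<lambda>j. j \<noteq> a \<and> j \<noteq> b", OF j(1)] by (auto simp: l_def)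
  show "l < 3"
    using Least_le[of "\<lambda>j. j \<noteq> a \<and> j \<noteq> b", OF j(1)] j(2) by (simp add: l_def)
qed

lemma greedy_colour_le: "greedy_colour T T' A n x \<le> 3"
  by (induction n) (auto intro: less_imp_le Least_avoiding_two)

lemma greedy_colour_stable:
  assumes "greedy_colour T T' A n x \<noteq> 3" "n \<le> m"
  shows "greedy_colour T T' A m x = greedy_colour T T' A n x"
  using assms(2,1) by (induction rule: dec_induct) auto

lemma greedy_colour_proper:
  assumes inv: "T' (T x) = x"
    and indep: "\<And>n. \<not> (x \<in> A n \<and> T x \<in> A n)"
    and "greedy_colour T T' A n x \<noteq> 3" "greedy_colour T T' A n (T x) \<noteq> 3"
  shows "greedy_colour T T' A n x \<noteq> greedy_colour T T' A n (T x)"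
  using assms(3,4)
proof (induction n)
  case (Suc n)
  let ?g = "greedy_colour T T' A n"
  consider (old) "?g x \<noteq> 3" "?g (T x) \<noteq> 3"
    | (left) "?g x = 3" "x \<in> A n" "T x \<notin> A n"
    | (right) "?g x \<noteq> 3" "?g (T x) = 3" "T x \<in> A n"
    using Suc.prems indep[of n] by (auto split: if_splits)
  then show ?case
  proof cases
    case old
    then show ?thesis using Suc.IH by simp
  next
    case left
    then show ?thesis
      using Least_avoiding_two(1)[of "?g (T x)" "?g (T' x)"] by simp
  next
    case right
    then show ?thesis
      using Least_avoiding_two(2)[where a = "?g (T (T x))" and b = "?g x"] inv by simp
  qed
qed simp

lemma measurable_greedy_colour:
  assumes [measurable]: "T \<in> M \<rightarrow>\<^sub>M M" "T' \<in> M \<rightarrow>\<^sub>M M" "\<And>n. A n \<in> sets M"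
  shows "greedy_colour T T' A n \<in> M \<rightarrow>\<^sub>M count_space UNIV"
proof (induction n)
  case (Suc n)
  note Suc[measurable]
  show ?case by simp
qed simp

text \<open>
  A set \<open>U\<close> from the separating family gives the set of points that leave \<open>U\<close> under \<open>T\<close>, which
  contains no point together with its image. As the family separates points, these sets cover
  everything that \<open>T\<close> moves, so every moved point eventually receives a proper colour and keeps it.
  Fixed points retain the value 3, which serves as a fourth colour.
\<close>
lemma finite_measurable_colouring:
  fixes T :: "'x \<Rightarrow> 'x"
  assumes T[measurable]: "T \<in> M \<rightarrow>\<^sub>M M" and T'[measurable]: "T' \<in> M \<rightarrow>\<^sub>M M"
    and inv: "\<And>x. x \<in> space M \<Longrightarrow> T' (T x) = x"
    and U[measurable]: "\<And>n. U n \<in> sets M"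
    and sep: "\<And>x y. x \<in> space M \<Longrightarrow> y \<in> space M \<Longrightarrow> x \<noteq> y \<Longrightarrow> \<exists>n::nat. x \<in> U n \<and> y \<notin> U n"
  obtains c :: "'x \<Rightarrow> nat"
  where "c \<in> M \<rightarrow>\<^sub>M count_space UNIV" "\<And>x. c x \<le> 3"
    "\<And>x. x \<in> space M \<Longrightarrow> T x \<noteq> x \<Longrightarrow> c (T x) \<noteq> c x"
proof
  define A where "A n = U n - (T -` U n \<inter> space M)" for n
  have A[measurable]: "A n \<in> sets M" for n by (simp add: A_def)
  let ?g = "greedy_colour T T' A"
  \<comment> \<open>Along the stages only the values 3 and at most one proper colour occur, so the least value is the final one.\<close>
  define c where "c x = (LEAST j. \<exists>n. ?g n x = j)" for x
  note measurable_greedy_colour[measurable]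
  show "c \<in> M \<rightarrow>\<^sub>M count_space UNIV" unfolding c_def by measurable
  have c_le: "c x \<le> ?g n x" for x n unfolding c_def by (rule Least_le) blast
  show "c x \<le> 3" for x using c_le[of x 0] by simp
  have c_eq: "c x = ?g n x" if "?g n x \<noteq> 3" for n x
  proof -
    obtain m where m: "?g m x = c x"
      unfolding c_def using LeastI[of "\<lambda>j. \<exists>n. ?g n x = j"] by blast
    have "?g n x < 3" using that greedy_colour_le[of T T' A n x] by simp
    then have "?g m x \<noteq> 3" using m c_le[of x n] by simp
    then show ?thesis
      using greedy_colour_stable[OF that, of m] greedy_colour_stable[of T T' A m x n] m
      by (cases "n \<le> m") simp_all
  qed
  have coloured: "?g (Suc n) x \<noteq> 3" if "x \<in> A n" for n x
    using that Least_avoiding_two(3)[of "?g n (T x)" "?g n (T' x)"] by simp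
  fix x assume x: "x \<in> space M" and "T x \<noteq> x"
  then have Tx: "T x \<in> space M" using measurable_space[OF T] by blast
  obtain n where n: "x \<in> A n" using sep[OF x Tx] \<open>T x \<noteq> x\<close> by (auto simp: A_def)
  have indep: "\<not> (x \<in> A k \<and> T x \<in> A k)" for k using x by (auto simp: A_def)
  show "c (T x) \<noteq> c x"
  proof (cases "\<exists>k. ?g k (T x) \<noteq> 3")
    case True
    then obtain k where k: "?g k (T x) \<noteq> 3" by blast
    let ?m = "max k (Suc n)"
    have "?g ?m (T x) \<noteq> 3" "?g ?m x \<noteq> 3"
      using greedy_colour_stable[OF k, of ?m] k
        greedy_colour_stable[OF coloured[OF n], of ?m] coloured[OF n] by simp_all
    then show ?thesis
      using greedy_colour_proper[of T' T x A, OF inv[OF x] indep, of ?m]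
        c_eq[of ?m x] c_eq[of ?m "T x"] by simp
  next
    case False
    then have "c (T x) = 3" unfolding c_def by (simp add: Least_equality)
    moreover have "c x \<noteq> 3" using c_eq[OF coloured[OF n]] coloured[OF n] by simp
    ultimately show ?thesis by simp
  qed
qed

text \<open>
  A countable base of a metrizable topology separates points. Adding the empty set to it
  makes it nonempty, so that a sequence can enumerate it.
\<close>
lemma standard_borel_separating_sequence:
  assumes "standard_borel X"
  obtains U :: "nat \<Rightarrow> 'x set"
  where "\<And>n. U n \<in> sets X"
    "\<And>x y. x \<in> space X \<Longrightarrow> y \<in> space X \<Longrightarrow> x \<noteq> y \<Longrightarrow> \<exists>n. x \<in> U n \<and> y \<notin> U n"
proof -
  obtain T where T: "completely_metrizable_space T" "second_countable T"
    "space X = topspace T" "sets X = sets (borel_of T)"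
    using assms unfolding standard_borel_def by blast
  obtain \<B> where \<B>: "countable \<B>" "\<And>V. V \<in> \<B> \<Longrightarrow> openin T V"
    "\<And>U x. openin T U \<Longrightarrow> x \<in> U \<Longrightarrow> \<exists>V\<in>\<B>. x \<in> V \<and> V \<subseteq> U"
    using T(2) unfolding second_countable_def by meson
  define U where "U = from_nat_into (insert {} \<B>)"
  have range: "range U = insert {} \<B>"
    unfolding U_def using \<B>(1) by (intro range_from_nat_into) auto
  show thesis
  proof
    fix n
    have "U n \<in> insert {} \<B>" using range by blast
    then have "openin T (U n)" using \<B>(2) by auto
    then have "U n \<in> sets (borel_of T)"
      unfolding borel_of_def by (subst sets_measure_of) (auto dest: openin_subset)
    then show "U n \<in> sets X" using T(4) by simp
  next
    fix x y assume "x \<in> space X" "y \<in> space X" "x \<noteq> y"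
    then obtain W where W: "openin T W" "x \<in> W" "y \<notin> W"
      using metrizable_imp_t1_space[OF completely_metrizable_imp_metrizable_space[OF T(1)]]
      unfolding t1_space_def T(3) by blast
    then obtain V where "V \<in> \<B>" "x \<in> V" "V \<subseteq> W" using \<B>(3) by blast
    moreover have "V \<in> range U" using range \<open>V \<in> \<B>\<close> by simp
    ultimately show "\<exists>n. x \<in> U n \<and> y \<notin> U n" using W(3) by blast
  qed
qed

lemma borel_action_colourings:
  assumes "standard_borel X" "borel_action G X \<alpha>"
  shows "\<exists>c :: 'a \<Rightarrow> 'x \<Rightarrow> nat. \<forall>g\<in>carrier G. c g \<in> X \<rightarrow>\<^sub>M count_space UNIV \<and>
    (\<forall>x. c g x \<le> 3) \<and> (\<forall>x\<in>space X. \<alpha> g x \<noteq> x \<longrightarrow> c g (\<alpha> g x) \<noteq> c g x)"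
proof -
  have act: "group_action G (space X) \<alpha>" and meas: "\<And>g. g \<in> carrier G \<Longrightarrow> \<alpha> g \<in> X \<rightarrow>\<^sub>M X"
    using assms(2) unfolding borel_action_def by blast+
  interpret group_action G "space X" \<alpha> by (rule act)
  interpret group G using group_hom group_hom.axioms(1) by auto
  obtain U :: "nat \<Rightarrow> 'x set" where U: "\<And>n. U n \<in> sets X"
    "\<And>x y. x \<in> space X \<Longrightarrow> y \<in> space X \<Longrightarrow> x \<noteq> y \<Longrightarrow> \<exists>n. x \<in> U n \<and> y \<notin> U n"
    using standard_borel_separating_sequence[OF assms(1)] by metis
  have "\<exists>c. c \<in> X \<rightarrow>\<^sub>M count_space UNIV \<and> (\<forall>x. c x \<le> (3::nat)) \<and>
      (\<forall>x\<in>space X. \<alpha> g x \<noteq> x \<longrightarrow> c (\<alpha> g x) \<noteq> c x)" if g: "g \<in> carrier G" for g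
  proof -
    obtain c :: "'x \<Rightarrow> nat" where "c \<in> X \<rightarrow>\<^sub>M count_space UNIV" "\<And>x. c x \<le> 3"
      "\<And>x. x \<in> space X \<Longrightarrow> \<alpha> g x \<noteq> x \<Longrightarrow> c (\<alpha> g x) \<noteq> c x"
    proof (rule finite_measurable_colouring[of "\<alpha> g" X "\<alpha> (inv\<^bsub>G\<^esub> g)" U])
      show "\<alpha> g \<in> X \<rightarrow>\<^sub>M X" "\<alpha> (inv\<^bsub>G\<^esub> g) \<in> X \<rightarrow>\<^sub>M X" using meas g by simp_all
      show "\<alpha> (inv\<^bsub>G\<^esub> g) (\<alpha> g x) = x" if "x \<in> space X" for x
        using orbit_sym_aux[OF g that] by simp
    qed (use U in auto)
    then show ?thesis by blast
  qed
  then show ?thesis by (intro bchoice ballI)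
qed

section \<open>Stabilizers in the space of subgroups\<close>

lemma topspace_subgroup_space: "topspace (subgroup_space G) = {H. subgroup H G}"
  by (auto simp: subgroup_space_def topspace_pullback_topology)

text \<open>
  The topology on subgroups is generated by membership of single elements, so continuity is
  checked one group element at a time, and for a two-valued coordinate it means that
  its preimages are clopen.
\<close>
lemma continuous_map_subgroup_space:
  assumes "\<And>x. x \<in> topspace T \<Longrightarrow> subgroup (f x) G"
    and "\<And>g. g \<in> carrier G \<Longrightarrow> openin T {x \<in> topspace T. g \<in> f x}"
    and "\<And>g. g \<in> carrier G \<Longrightarrow> closedin T {x \<in> topspace T. g \<in> f x}"
  shows "continuous_map T (subgroup_space G) f"
  unfolding subgroup_space_def
proof (rule continuous_map_pullback')
  show "topspace T \<subseteq> f -` {H. subgroup H G}" using assms(1) by auto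
  have "continuous_map T (discrete_topology UNIV) (\<lambda>x. g \<in> f x)" if g: "g \<in> carrier G" for g
  proof (unfold continuous_map_def, intro conjI allI impI)
    fix U :: "bool set"
    have "{x \<in> topspace T. g \<notin> f x} = topspace T - {x \<in> topspace T. g \<in> f x}" by auto
    then have "openin T {x \<in> topspace T. g \<notin> f x}"
      using assms(3)[OF g] by (simp add: openin_diff)
    moreover have "{x \<in> topspace T. (g \<in> f x) \<in> U} =
        (if True \<in> U then {x \<in> topspace T. g \<in> f x} else {}) \<union>
        (if False \<in> U then {x \<in> topspace T. g \<notin> f x} else {})"
      (is "?L = ?R")
    proof (rule Set.set_eqI)
      fix x show "x \<in> ?L \<longleftrightarrow> x \<in> ?R" by (cases "g \<in> f x") simp_all
    qed
    ultimately show "openin T {x \<in> topspace T. (g \<in> f x) \<in> U}"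
      using assms(2)[OF g] by (simp add: openin_Un)
  qed simp
  then show "continuous_map T (product_topology (\<lambda>_. discrete_topology UNIV) (carrier G))
      ((\<lambda>H. \<lambda>g\<in>carrier G. g \<in> H) \<circ> f)"
    unfolding continuous_map_componentwise by (auto simp: extensional_def)
qed

lemma Hausdorff_subgroup_space: "Hausdorff_space (subgroup_space G)"
proof -
  let ?P = "product_topology (\<lambda>_. discrete_topology (UNIV :: bool set)) (carrier G)"
  have sub: "openin (subgroup_space G) {H. subgroup H G \<and> (g \<in> H) = b}" if g: "g \<in> carrier G" for g b
  proof -
    have "openin ?P {x \<in> topspace ?P. x g \<in> {b}}"
      using continuous_map_product_projection[OF g, of "\<lambda>_. discrete_topology (UNIV :: bool set)"]
      by (rule openin_continuous_map_preimage) simp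
    then have "openin (subgroup_space G)
        ((\<lambda>H. \<lambda>g\<in>carrier G. g \<in> H) -` {x \<in> topspace ?P. x g \<in> {b}} \<inter> {H. subgroup H G})"
      unfolding subgroup_space_def openin_pullback_topology by blast
    moreover have "(\<lambda>H. \<lambda>g\<in>carrier G. g \<in> H) -` {x \<in> topspace ?P. x g \<in> {b}} \<inter> {H. subgroup H G}
        = {H. subgroup H G \<and> (g \<in> H) = b}"
      using g by auto
    ultimately show ?thesis by simp
  qed
  show ?thesis
    unfolding Hausdorff_space_def
  proof (intro allI impI)
    fix H K assume "H \<in> topspace (subgroup_space G) \<and> K \<in> topspace (subgroup_space G) \<and> H \<noteq> K"
    then have HK: "subgroup H G" "subgroup K G" "H \<noteq> K" by (simp_all add: topspace_subgroup_space)
    then obtain g where g: "(g \<in> H) \<noteq> (g \<in> K)" by blast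
    then have "g \<in> carrier G" using HK subgroup.subset by blast
    then show "\<exists>U V. openin (subgroup_space G) U \<and> openin (subgroup_space G) V \<and> H \<in> U \<and> K \<in> V \<and> disjnt U V"
      using sub[of g "g \<in> H"] sub[of g "g \<in> K"] HK g
      by (intro exI[of _ "{L. subgroup L G \<and> (g \<in> L) = (g \<in> H)}"]
            exI[of _ "{L. subgroup L G \<and> (g \<in> L) = (g \<in> K)}"]) (auto simp: disjnt_def)
  qed
qed

lemma (in group_action) conjugate_stabilizer:
  assumes x: "x \<in> E" and g: "g \<in> carrier G"
  shows "conjugate_set G g (stabilizer G \<phi> x) = stabilizer G \<phi> (\<phi> g x)"
proof -
  interpret group G using group_hom group_hom.axioms(1) by auto
  have gx: "\<phi> g x \<in> E" using element_image[OF g x] by simp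
  have undo: "\<phi> (inv g) (\<phi> g x) = x" using orbit_sym_aux[OF g x] by simp
  have elt: "conjugate_set G g H = {g \<otimes> h \<otimes> inv g | h. h \<in> H}" for H
    by (auto simp: conjugate_set_def l_coset_def r_coset_def)
  show ?thesis
    unfolding elt
  proof (intro equalityI subsetI)
    fix k assume "k \<in> {g \<otimes> h \<otimes> inv g | h. h \<in> stabilizer G \<phi> x}"
    then obtain h where h: "k = g \<otimes> h \<otimes> inv g" "h \<in> carrier G" "\<phi> h x = x"
      by (auto simp: stabilizer_def)
    then have "\<phi> k (\<phi> g x) = \<phi> g x"
      using gx x g undo by (simp add: composition_rule)
    then show "k \<in> stabilizer G \<phi> (\<phi> g x)" using h g by (simp add: stabilizer_def)
  next
    fix k assume "k \<in> stabilizer G \<phi> (\<phi> g x)"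
    then have k: "k \<in> carrier G" "\<phi> k (\<phi> g x) = \<phi> g x" by (auto simp: stabilizer_def)
    have "\<phi> (inv g \<otimes> k \<otimes> g) x = x"
      using k g x gx undo by (simp add: composition_rule)
    then have "inv g \<otimes> k \<otimes> g \<in> stabilizer G \<phi> x" using k g by (simp add: stabilizer_def)
    moreover have "k = g \<otimes> (inv g \<otimes> k \<otimes> g) \<otimes> inv g"
    proof -
      have "g \<otimes> (inv g \<otimes> k \<otimes> g) = k \<otimes> g"
        using k g by (simp add: m_assoc[symmetric])
      then show ?thesis using k g by (simp add: m_assoc)
    qed
    ultimately show "k \<in> {g \<otimes> h \<otimes> inv g | h. h \<in> stabilizer G \<phi> x}" by blast
  qed
qed

text \<open>
  The image is compact, hence closed in the Hausdorff space of subgroups; it is conjugation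
  invariant because translating a point conjugates its stabilizer. Minimality of \<open>Z\<close> does the rest.
\<close>
lemma stabilizer_image_eq_urs:
  assumes urs: "uniformly_recurrent_subgroup G Z"
    and act: "group_action G (topspace T) \<beta>"
    and T: "compact_space T" "topspace T \<noteq> {}"
    and cont: "continuous_map T (subgroup_space G) (stabilizer G \<beta>)"
    and stab: "stabilizers_in G Z (topspace T) \<beta>"
  shows "stabilizer G \<beta> ` topspace T = Z"
proof -
  interpret group_action G "topspace T" \<beta> by (rule act)
  let ?Y = "stabilizer G \<beta> ` topspace T"
  have "compactin (subgroup_space G) ?Y"
    by (rule image_compactin[OF T(1)[unfolded compact_space_def] cont])
  then have "closedin (subgroup_space G) ?Y"
    by (rule compactin_imp_closedin[OF Hausdorff_subgroup_space])
  moreover have "conj_invariant G ?Y"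
    unfolding conj_invariant_def
  proof (intro ballI)
    fix g H assume g: "g \<in> carrier G" and "H \<in> ?Y"
    then obtain x where x: "x \<in> topspace T" "H = stabilizer G \<beta> x" by blast
    show "conjugate_set G g H \<in> ?Y"
      unfolding x(2) conjugate_stabilizer[OF x(1) g]
      by (rule imageI) (rule element_image[OF g x(1) refl])
  qed
  moreover have "?Y \<noteq> {}" "?Y \<subseteq> Z"
    using T(2) stab by (auto simp: stabilizers_in_def)
  ultimately show ?thesis
    using urs unfolding uniformly_recurrent_subgroup_def by metis
qed

lemma group_action_UNIV:
  assumes "group G"
    and one: "\<And>x. \<phi> \<one>\<^bsub>G\<^esub> x = x"
    and mult: "\<And>g h x. g \<in> carrier G \<Longrightarrow> h \<in> carrier G \<Longrightarrow> \<phi> (g \<otimes>\<^bsub>G\<^esub> h) x = \<phi> g (\<phi> h x)"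
  shows "group_action G UNIV \<phi>"
proof -
  interpret group G by (rule assms(1))
  have bij: "\<phi> g \<in> Bij UNIV" if g: "g \<in> carrier G" for g
  proof -
    have "\<phi> (inv\<^bsub>G\<^esub> g) (\<phi> g x) = x" "\<phi> g (\<phi> (inv\<^bsub>G\<^esub> g) x) = x" for x
      using mult[of "inv\<^bsub>G\<^esub> g" g x] mult[of g "inv\<^bsub>G\<^esub> g" x] g one by simp_all
    then show ?thesis
      by (auto simp: Bij_def intro!: bij_betw_byWitness[where f' = "\<phi> (inv\<^bsub>G\<^esub> g)"])
  qed
  have "\<phi> \<in> hom G (BijGroup UNIV)"
    by (rule homI) (auto simp: BijGroup_def bij mult compose_def)
  then show ?thesis
    by (intro group_action.intro group_hom.intro assms(1) group_BijGroup group_hom_axioms.intro)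
qed

section \<open>Coding a coloured action by binary sequences\<close>

text \<open>
  A Borel action together with a Borel colouring \<open>c g\<close>, for each group element \<open>g\<close>, in which no
  point moved by \<open>g\<close> has the colour of its image. The common bound on the colours is what makes
  the colour comparison \<open>same_colour\<close> below depend on finitely many coordinates only.
\<close>
locale coloured_borel_action = group_action G "space X" \<alpha>
  for G :: "('a, 'm) monoid_scheme" (structure) and X :: "'x measure" and \<alpha> :: "'a \<Rightarrow> 'x \<Rightarrow> 'x" +
  fixes c :: "'a \<Rightarrow> 'x \<Rightarrow> nat"
  assumes countable_carrier: "countable (carrier G)"
    and measurable_action: "\<And>g. g \<in> carrier G \<Longrightarrow> \<alpha> g \<in> X \<rightarrow>\<^sub>M X"
    and measurable_colour: "\<And>g. g \<in> carrier G \<Longrightarrow> c g \<in> X \<rightarrow>\<^sub>M count_space UNIV"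
    and colour_le: "\<And>g x. g \<in> carrier G \<Longrightarrow> c g x \<le> 3"
    and colour_proper: "\<And>g x. g \<in> carrier G \<Longrightarrow> x \<in> space X \<Longrightarrow> \<alpha> g x \<noteq> x \<Longrightarrow> c g (\<alpha> g x) \<noteq> c g x"
begin

text \<open>
  The index \<open>(d, g, j)\<close> stands for the question whether the translate by \<open>d\<close> has \<open>g\<close>-colour \<open>j\<close>. 
\<close>
definition colour_index :: "('a \<times> 'a \<times> nat) set" where
  "colour_index = carrier G \<times> carrier G \<times> UNIV"

definition colour_pos :: "'a \<Rightarrow> 'a \<Rightarrow> nat \<Rightarrow> nat" where
  "colour_pos d g j = 2 * to_nat_on colour_index (d, g, j)"

text \<open>
  The even coordinates answer the questions of \<open>colour_index\<close> about \<open>x\<close>. The odd ones carry the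
  arbitrary sequence \<open>w\<close>, whose only purpose is to leave no isolated points.
\<close>
definition colour_code ::
  "'x \<Rightarrow> (nat \<Rightarrow> bool) \<Rightarrow> nat \<Rightarrow> bool" where
  "colour_code x w n =
     (if even n then (case from_nat_into colour_index (n div 2) of (d, g, j) \<Rightarrow> c g (\<alpha> d x) = j)
      else w (n div 2))"

text \<open>
  The \<open>g\<close>-colour of \<open>\<alpha> d (\<alpha> h x)\<close> is that of \<open>\<alpha> (d \<otimes> h) x\<close>, so translating \<open>x\<close> by \<open>h\<close> moves even
  coordinates along right multiplication by \<open>h\<close>. The
  prescription makes sense and is continuous on all sequences.
\<close>
definition shift_code :: "'a \<Rightarrow> (nat \<Rightarrow> bool) \<Rightarrow> nat \<Rightarrow> bool" where
  "shift_code h y n =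
     (if even n then (case from_nat_into colour_index (n div 2) of
        (d, g, j) \<Rightarrow> y (colour_pos (d \<otimes> h) g j))
      else y n)"

definition same_colour :: "'a \<Rightarrow> (nat \<Rightarrow> bool) set" where
  "same_colour g = {y. \<forall>j\<le>3. y (colour_pos \<one> g j) = y (colour_pos g g j)}"

lemma open_same_colour: "open (same_colour g)"
proof -
  have "same_colour g = (\<Inter>j\<in>{..3}. {y. y (colour_pos \<one> g j) = y (colour_pos g g j)})"
    by (auto simp: same_colour_def)
  then show ?thesis by (simp only:) (intro open_INT finite_atMost ballI open_coordinates_agree)
qed

lemma continuous_on_shift_code: "continuous_on UNIV (shift_code h)"
proof (rule continuous_on_coordinatewise_then_product)
  fix n
  obtain d g j where "from_nat_into colour_index (n div 2) = (d, g, j)" by (metis surj_pair)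
  then have "(\<lambda>y. shift_code h y n) =
      (\<lambda>y. y (if even n then colour_pos (d \<otimes> h) g j else n))"
    by (auto simp: shift_code_def)
  then show "continuous_on UNIV (\<lambda>y. shift_code h y n)"
    by (simp only: continuous_on_product_coordinates)
qed

interpretation group G using group_hom group_hom.axioms(1) by auto

lemma from_nat_into_colour_index:
  obtains d g j where "from_nat_into colour_index n = (d, g, j)" "d \<in> carrier G" "g \<in> carrier G"
proof -
  have "from_nat_into colour_index n \<in> colour_index"
    by (rule from_nat_into) (auto simp: colour_index_def)
  then show thesis using that by (auto simp: colour_index_def)
qed

lemma from_nat_into_colour_pos:
  assumes "d \<in> carrier G" "g \<in> carrier G"
  shows "from_nat_into colour_index (colour_pos d g j div 2) = (d, g, j)"
  using assms countable_carrier by (simp add: colour_pos_def colour_index_def)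

lemma even_colour_pos: "even (colour_pos d g j)"
  by (simp add: colour_pos_def)

lemma colour_code_pos:
  assumes "d \<in> carrier G" "g \<in> carrier G"
  shows "colour_code x w (colour_pos d g j) \<longleftrightarrow> c g (\<alpha> d x) = j"
  using from_nat_into_colour_pos[OF assms] by (simp add: colour_code_def even_colour_pos)

lemma shift_code_pos:
  assumes "d \<in> carrier G" "g \<in> carrier G"
  shows "shift_code h y (colour_pos d g j) = y (colour_pos (d \<otimes> h) g j)"
  using from_nat_into_colour_pos[OF assms] by (simp add: shift_code_def even_colour_pos)

lemma shift_code_colour_code:
  assumes h: "h \<in> carrier G" and x: "x \<in> space X"
  shows "shift_code h (colour_code x w) = colour_code (\<alpha> h x) w"
proof
  fix n
  obtain d g j where "from_nat_into colour_index (n div 2) = (d, g, j)"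
    "d \<in> carrier G" "g \<in> carrier G" by (rule from_nat_into_colour_index)
  then show "shift_code h (colour_code x w) n = colour_code (\<alpha> h x) w n"
    using h x colour_code_pos[of "d \<otimes> h" g x w j]
    by (simp add: shift_code_def colour_code_def[of "\<alpha> h x"] composition_rule)
       (simp add: colour_code_def)
qed

definition codes :: "(nat \<Rightarrow> bool) set" where
  "codes = {colour_code x w | x w. x \<in> space X}"

lemma shift_code_closure_codes:
  assumes "h \<in> carrier G" "y \<in> closure codes"
  shows "shift_code h y \<in> closure codes"
proof -
  have "shift_code h ` codes \<subseteq> codes"
    using assms(1) shift_code_colour_code element_image unfolding codes_def by blast
  then have "shift_code h ` closure codes \<subseteq> closure codes"
    using closure_subset by (intro image_closure_subset)
      (auto intro: continuous_on_subset[OF continuous_on_shift_code])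
  then show ?thesis using assms(2) by blast
qed

lemma shift_code_one:
  assumes "y \<in> closure codes"
  shows "shift_code \<one> y = y"
proof (rule closure_subset_eqlocus[OF continuous_on_shift_code continuous_on_id _ assms])
  fix y assume "y \<in> codes"
  then obtain x w where "y = colour_code x w" "x \<in> space X" by (auto simp: codes_def)
  then show "shift_code \<one> y = y"
    using shift_code_colour_code[of \<one> x w] id_eq_one by (metis one_closed restrict_apply')
qed

lemma shift_code_mult:
  assumes g: "g \<in> carrier G" and h: "h \<in> carrier G" and y: "y \<in> closure codes"
  shows "shift_code (g \<otimes> h) y = shift_code g (shift_code h y)"
proof (rule closure_subset_eqlocus[OF continuous_on_shift_code _ _ y])
  show "continuous_on UNIV (\<lambda>y. shift_code g (shift_code h y))"
    by (rule continuous_on_compose2[OF continuous_on_shift_code continuous_on_shift_code]) simp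
  fix y assume "y \<in> codes"
  then obtain x w where y: "y = colour_code x w" and x: "x \<in> space X"
    by (auto simp: codes_def)
  have hx: "\<alpha> h x \<in> space X" using element_image[OF h x] by simp
  show "shift_code (g \<otimes> h) y = shift_code g (shift_code h y)"
    unfolding y shift_code_colour_code[OF h x] shift_code_colour_code[OF g hx]
      shift_code_colour_code[OF m_closed[OF g h] x] composition_rule[OF x g h] ..
qed

text \<open>
  For codes, agreement of the positions at \<open>\<one>\<close> and at \<open>g\<close> says that \<open>x\<close> and \<open>\<alpha> g x\<close> have the same
  \<open>g\<close>-colour, which a proper colouring allows only if \<open>g\<close> fixes \<open>x\<close>.
\<close>
lemma same_colour_code:
  assumes g: "g \<in> carrier G" and x: "x \<in> space X"
    and same: "colour_code x w \<in> same_colour g"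
  shows "\<alpha> g x = x"
proof -
  have one: "\<alpha> \<one> x = x" using id_eq_one x by (metis restrict_apply')
  have "(c g (\<alpha> \<one> x) = j) = (c g (\<alpha> g x) = j)" if "j \<le> 3" for j
    using same that colour_code_pos[OF one_closed g, of x w j] colour_code_pos[OF g g, of x w j]
    by (simp add: same_colour_def)
  then have "c g (\<alpha> g x) = c g x" using colour_le[OF g, of x] one by metis
  then show ?thesis using colour_proper[OF g x] by blast
qed

text \<open>
  From left to right this holds for any sequence, since the shift by \<open>g\<close> moves the position at \<open>g\<close> to
  the one at \<open>\<one>\<close>. Conversely, as \<open>same_colour g\<close> is open, a point of it that is a limit of codes is a
  limit of codes inside it; these are fixed by the shift, hence so is the limit.
\<close>
lemma shift_code_fixes_iff:
  assumes g: "g \<in> carrier G" and y: "y \<in> closure codes"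
  shows "shift_code g y = y \<longleftrightarrow> y \<in> same_colour g"
proof
  assume fixed: "shift_code g y = y"
  have "y (colour_pos \<one> g j) = y (colour_pos g g j)" for j
    using shift_code_pos[OF one_closed g, of g y j] unfolding fixed l_one[OF g] .
  then show "y \<in> same_colour g" unfolding same_colour_def by blast
next
  assume "y \<in> same_colour g"
  with y have "y \<in> closure (same_colour g \<inter> codes)"
    by (intro subsetD[OF open_Int_closure_subset[OF open_same_colour]] IntI)
  then show "shift_code g y = y"
  proof (rule closure_subset_eqlocus[OF continuous_on_shift_code continuous_on_id, rotated])
    fix z assume z: "z \<in> same_colour g \<inter> codes"
    then obtain x w where zx: "z = colour_code x w" and x: "x \<in> space X"
      by (auto simp: codes_def)
    have "\<alpha> g x = x" using same_colour_code[OF g x, of w] z zx by simp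
    then show "shift_code g z = z" using shift_code_colour_code[OF g x, of w] zx by simp
  qed
qed

text \<open>
  Flipping one odd coordinate is continuous and permutes the codes, so it preserves their
  closure; the coordinate can be chosen beyond any given prefix.
\<close>
lemma closure_codes_perfect:
  assumes "y \<in> closure codes"
  shows "\<exists>y'\<in>closure codes. y' \<noteq> y \<and> (\<forall>m<n. y' m = y m)"
proof -
  define flip :: "(nat \<Rightarrow> bool) \<Rightarrow> nat \<Rightarrow> bool" where "flip = (\<lambda>y. y(2 * n + 1 := \<not> y (2 * n + 1)))"
  have "continuous_on UNIV (\<lambda>y. flip y m)" for m
  proof (cases "m = 2 * n + 1")
    case True
    have "(\<lambda>y :: nat \<Rightarrow> bool. \<not> y m) -` W = (\<lambda>y. y m) -` (Not -` W)" for W by auto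
    then have "open ((\<lambda>y :: nat \<Rightarrow> bool. \<not> y m) -` W)" for W
      using open_coordinate_vimage[OF Topological_Spaces.open_discrete] by metis
    then show ?thesis
      using True by (simp add: flip_def continuous_on_open_vimage)
  next
    case False
    then show ?thesis by (simp add: flip_def)
  qed
  then have cont: "continuous_on UNIV flip" by (rule continuous_on_coordinatewise_then_product)
  have "flip (colour_code x w) = colour_code x (w(n := \<not> w n))" for x w
    by (rule ext) (auto simp: flip_def colour_code_def, presburger)
  then have "flip ` codes \<subseteq> codes" unfolding codes_def by blast
  then have "flip ` closure codes \<subseteq> closure codes"
    using closure_subset by (intro image_closure_subset) (auto intro: continuous_on_subset[OF cont])
  then have "flip y \<in> closure codes" using assms by blast
  moreover have "flip y \<noteq> y"
    unfolding flip_def by (metis fun_upd_same)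
  moreover have "\<forall>m<n. flip y m = y m" by (simp add: flip_def)
  ultimately show ?thesis by blast
qed

lemma measurable_colour_code:
  "(\<lambda>x. colour_code x w) \<in> borel_measurable X"
proof (rule measurable_coordinatewise_then_product)
  fix n
  obtain d g j where idx: "from_nat_into colour_index (n div 2) = (d, g, j)"
    "d \<in> carrier G" "g \<in> carrier G" by (rule from_nat_into_colour_index)
  have "(\<lambda>x. c g (\<alpha> d x)) \<in> X \<rightarrow>\<^sub>M count_space UNIV"
    by (rule measurable_compose[OF measurable_action[OF idx(2)] measurable_colour[OF idx(3)]])
  then have "(\<lambda>x. c g (\<alpha> d x) = j) \<in> X \<rightarrow>\<^sub>M count_space UNIV" by measurable
  then have "(\<lambda>x. c g (\<alpha> d x) = j) \<in> borel_measurable X"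
    by (rule measurable_compose) simp
  then show "(\<lambda>x. colour_code x w n) \<in> borel_measurable X"
    using idx(1) by (cases "even n") (simp_all add: colour_code_def)
qed

end

section \<open>The action on the Cantor set\<close>

text \<open>
  The space \<open>X\<close>, or rather its product with the auxiliary sequences \<open>w\<close>, is mapped equivariantly and
  with the same stabilizers onto a dense part of the Cantor set, whose action has clopen fixed
  point sets. Each \<open>\<beta> g\<close> is the shift by \<open>g\<close> transported by a homeomorphism from the closure of the codes.
\<close>
lemma cantor_model:
  fixes G :: "('a, 'm) monoid_scheme" (structure)
    and X :: "'x measure" and \<alpha> :: "'a \<Rightarrow> 'x \<Rightarrow> 'x"
  assumes "group G" "countable (carrier G)" "standard_borel X" "borel_action G X \<alpha>"
    and ne: "space X \<noteq> {}"
  shows "\<exists>(\<beta> :: 'a \<Rightarrow> (nat \<Rightarrow> bool) \<Rightarrow> nat \<Rightarrow> bool) (F :: 'x \<Rightarrow> (nat \<Rightarrow> bool) \<Rightarrow> nat \<Rightarrow> bool).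
    group_action G UNIV \<beta> \<and>
    (\<forall>g\<in>carrier G. continuous_on UNIV (\<beta> g) \<and> open {z. \<beta> g z = z}) \<and>
    (\<forall>w. (\<lambda>x. F x w) \<in> borel_measurable X) \<and>
    closure {F x w | x w. x \<in> space X} = UNIV \<and>
    (\<forall>g\<in>carrier G. \<forall>x\<in>space X. \<forall>w.
      \<beta> g (F x w) = F (\<alpha> g x) w \<and> (\<beta> g (F x w) = F x w \<longleftrightarrow> \<alpha> g x = x))"
proof -
  interpret group G by (rule assms(1))
  have act: "group_action G (space X) \<alpha>" and meas: "\<And>g. g \<in> carrier G \<Longrightarrow> \<alpha> g \<in> X \<rightarrow>\<^sub>M X"
    using assms(4) unfolding borel_action_def by blast+
  obtain c :: "'a \<Rightarrow> 'x \<Rightarrow> nat"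
    where colouring: "\<forall>g\<in>carrier G. c g \<in> X \<rightarrow>\<^sub>M count_space UNIV \<and>
      (\<forall>x. c g x \<le> 3) \<and> (\<forall>x\<in>space X. \<alpha> g x \<noteq> x \<longrightarrow> c g (\<alpha> g x) \<noteq> c g x)"
    using borel_action_colourings[OF assms(3,4)] by (rule exE)
  interpret group_action G "space X" \<alpha> by (rule act)
  interpret coloured_borel_action G X \<alpha> c
    using colouring meas assms(2) by unfold_locales simp_all
  define P where "P = closure codes"
  have code_P: "colour_code x w \<in> P" if "x \<in> space X" for x w
    unfolding P_def using that by (intro subsetD[OF closure_subset]) (auto simp: codes_def)
  have "P \<noteq> {}" using code_P ne by blast
  obtain h k :: "(nat \<Rightarrow> bool) \<Rightarrow> nat \<Rightarrow> bool" where hk: "homeomorphism P UNIV h k"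
  proof (rule perfect_closed_homeomorphic_cantor)
    show "\<exists>y\<in>P. y \<noteq> x \<and> (\<forall>m<n. y m = x m)" if "x \<in> P" for x n
      using closure_codes_perfect that unfolding P_def by blast
  qed (use \<open>P \<noteq> {}\<close> in \<open>auto simp: P_def\<close>)
  have h: "continuous_on P h" and k: "continuous_on UNIV k"
    and kh: "\<And>y. y \<in> P \<Longrightarrow> k (h y) = y" and hkz: "\<And>z. h (k z) = z"
    and kP: "\<And>z. k z \<in> P"
    using hk unfolding homeomorphism_def by auto
  define \<beta> where "\<beta> = (\<lambda>g z. h (shift_code g (k z)))"
  define F where "F = (\<lambda>x w. h (colour_code x w))"
  have shift: "shift_code g y \<in> P" if "g \<in> carrier G" "y \<in> P" for g y
    using shift_code_closure_codes that unfolding P_def by blast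
  have fixes_iff: "\<beta> g z = z \<longleftrightarrow> k z \<in> same_colour g" if g: "g \<in> carrier G" for g z
  proof -
    have "\<beta> g z = z \<longleftrightarrow> shift_code g (k z) = k z"
      unfolding \<beta>_def using kh[OF shift[OF g kP]] hkz by metis
    also have "\<dots> \<longleftrightarrow> k z \<in> same_colour g"
      using shift_code_fixes_iff[OF g] kP unfolding P_def by blast
    finally show ?thesis .
  qed
  have equivariant: "\<beta> g (F x w) = F (\<alpha> g x) w" if "g \<in> carrier G" "x \<in> space X" for g x w
    unfolding \<beta>_def F_def kh[OF code_P[OF that(2)]]
    using shift_code_colour_code[OF that] by simp
  show ?thesis
  proof (intro exI conjI ballI allI)
    show "group_action G UNIV \<beta>"
    proof (rule group_action_UNIV[OF assms(1)])
      show "\<beta> \<one> z = z" for z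
        using shift_code_one kP hkz by (simp add: \<beta>_def P_def)
      show "\<beta> (g \<otimes> g') z = \<beta> g (\<beta> g' z)" if "g \<in> carrier G" "g' \<in> carrier G" for g g' z
        using shift_code_mult[OF that] kP kh[OF shift[OF that(2) kP]]
        by (simp add: \<beta>_def P_def)
    qed
  next
    fix g assume g: "g \<in> carrier G"
    have "continuous_on UNIV (\<lambda>z. shift_code g (k z))"
      by (rule continuous_on_compose2[OF continuous_on_shift_code k]) simp
    then show "continuous_on UNIV (\<beta> g)"
      unfolding \<beta>_def by (rule continuous_on_compose2[OF h]) (use shift[OF g kP] in blast)
    have "{z. \<beta> g z = z} = k -` same_colour g" using fixes_iff[OF g] by blast
    then show "open {z. \<beta> g z = z}" using open_vimage[OF open_same_colour k] by simp
  next
    fix w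
    have "(\<lambda>x. colour_code x w) \<in> X \<rightarrow>\<^sub>M restrict_space borel P"
      using code_P measurable_colour_code[of w]
      by (intro measurable_restrict_space2) auto
    then show "(\<lambda>x. F x w) \<in> borel_measurable X"
      unfolding F_def by (rule measurable_compose[OF _ borel_measurable_continuous_on_restrict[OF h]])
  next
    let ?I = "{F x w | x w. x \<in> space X}"
    have "h ` codes \<subseteq> ?I" by (auto simp: F_def codes_def)
    then have "h ` P \<subseteq> closure ?I"
      using h closure_subset[of ?I] unfolding P_def by (intro image_closure_subset) auto
    moreover have "h ` P = UNIV" using hk by (simp add: homeomorphism_def)
    ultimately show "closure ?I = UNIV" by blast
  next
    fix g x w assume g: "g \<in> carrier G" and x: "x \<in> space X"
    show "\<beta> g (F x w) = F (\<alpha> g x) w" by (rule equivariant[OF g x])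
    show "\<beta> g (F x w) = F x w \<longleftrightarrow> \<alpha> g x = x"
    proof
      assume "\<beta> g (F x w) = F x w"
      then have "colour_code x w \<in> same_colour g"
        using fixes_iff[OF g] kh[OF code_P[OF x]] by (simp add: F_def)
      then show "\<alpha> g x = x" using same_colour_code[OF g x] by simp
    qed (simp add: equivariant[OF g x])
  qed
qed

theorem corollary1p1:
  fixes G :: "('a, 'm) monoid_scheme"
    and Z :: "'a set set"
    and X :: "'x measure"
    and \<alpha> :: "'a \<Rightarrow> 'x \<Rightarrow> 'x"
  assumes "group G" and "countable (carrier G)"
    and "uniformly_recurrent_subgroup G Z"
    and "standard_borel X"
    and "borel_action G X \<alpha>"
    and "stabilizers_in G Z (space X) \<alpha>"
    and "admits_invariant_probability G X \<alpha>"
  shows "\<exists>\<beta> :: 'a \<Rightarrow> (nat \<Rightarrow> bool) \<Rightarrow> (nat \<Rightarrow> bool).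
           continuous_action G cantor_space \<beta> \<and>
           stabilizers_in G Z (topspace cantor_space) \<beta> \<and>
           admits_invariant_probability G (borel_of cantor_space) \<beta> \<and>
           continuous_map cantor_space (subgroup_space G) (stabilizer G \<beta>) \<and>
           stabilizer G \<beta> ` topspace cantor_space = Z"
proof -
  interpret group G by (rule assms(1))
  obtain \<mu> where "prob_space \<mu>" and \<mu>: "sets \<mu> = sets X" "\<And>g. g \<in> carrier G \<Longrightarrow> distr \<mu> X (\<alpha> g) = \<mu>"
    using assms(7) unfolding admits_invariant_probability_def by blast
  interpret \<mu>: prob_space \<mu> by fact
  have "space X \<noteq> {}" using \<mu>.not_empty sets_eq_imp_space_eq[OF \<mu>(1)] by simp
  from cantor_model[OF assms(1,2,4,5) this]
  obtain \<beta> :: "'a \<Rightarrow> (nat \<Rightarrow> bool) \<Rightarrow> nat \<Rightarrow> bool" and F :: "'x \<Rightarrow> (nat \<Rightarrow> bool) \<Rightarrow> nat \<Rightarrow> bool"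
    where model: "group_action G UNIV \<beta> \<and>
      (\<forall>g\<in>carrier G. continuous_on UNIV (\<beta> g) \<and> open {z. \<beta> g z = z}) \<and>
      (\<forall>w. (\<lambda>x. F x w) \<in> borel_measurable X) \<and>
      closure {F x w | x w. x \<in> space X} = UNIV \<and>
      (\<forall>g\<in>carrier G. \<forall>x\<in>space X. \<forall>w.
        \<beta> g (F x w) = F (\<alpha> g x) w \<and> (\<beta> g (F x w) = F x w \<longleftrightarrow> \<alpha> g x = x))"
    by (elim exE)
  have \<beta>: "group_action G UNIV \<beta>"
    and cont: "\<And>g. g \<in> carrier G \<Longrightarrow> continuous_on UNIV (\<beta> g)"
    and open_fix: "\<And>g. g \<in> carrier G \<Longrightarrow> open {z. \<beta> g z = z}"
    and F_meas: "\<And>w. (\<lambda>x. F x w) \<in> borel_measurable X"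
    and dense: "closure {F x w | x w. x \<in> space X} = UNIV"
    and F_equiv: "\<And>g x w. g \<in> carrier G \<Longrightarrow> x \<in> space X \<Longrightarrow> \<beta> g (F x w) = F (\<alpha> g x) w"
    and F_stab: "\<And>g x w. g \<in> carrier G \<Longrightarrow> x \<in> space X \<Longrightarrow> \<beta> g (F x w) = F x w \<longleftrightarrow> \<alpha> g x = x"
    using model by blast+
  interpret B: group_action G UNIV \<beta> by (rule \<beta>)
  note cantor = cantor_space_eq_euclidean
  have \<alpha>_meas: "\<And>g. g \<in> carrier G \<Longrightarrow> \<alpha> g \<in> X \<rightarrow>\<^sub>M X"
    using assms(5) unfolding borel_action_def by blast
  have action: "continuous_action G cantor_space \<beta>"
    unfolding continuous_action_def cantor
  proof (intro conjI ballI)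
    fix g assume g: "g \<in> carrier G"
    have "homeomorphic_maps euclidean euclidean (\<beta> g) (\<beta> (inv\<^bsub>G\<^esub> g))"
      unfolding homeomorphic_maps_def
      using cont g B.orbit_sym_aux[OF g, of _ "\<beta> g _"] B.orbit_sym_aux[of "inv\<^bsub>G\<^esub> g"]
      by (simp add: continuous_map_iff_continuous2)
    then show "homeomorphic_map euclidean euclidean (\<beta> g)"
      unfolding homeomorphic_maps_map by blast
  qed (simp add: \<beta>)
  have stab_cont: "continuous_map cantor_space (subgroup_space G) (stabilizer G \<beta>)"
    unfolding cantor
  proof (rule continuous_map_subgroup_space)
    fix g assume g: "g \<in> carrier G"
    have eq: "{z \<in> topspace euclidean. g \<in> stabilizer G \<beta> z} = {z. \<beta> g z = z}"
      using g by (simp add: stabilizer_def)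
    show "openin euclidean {z \<in> topspace euclidean. g \<in> stabilizer G \<beta> z}"
      unfolding eq using open_fix[OF g] by (simp only: open_openin)
    have "closed {z. \<beta> g z = z}" by (rule closed_Collect_eq[OF cont[OF g] continuous_on_id])
    then show "closedin euclidean {z \<in> topspace euclidean. g \<in> stabilizer G \<beta> z}"
      unfolding eq by (simp only: closed_closedin)
  qed (rule B.stabilizer_subgroup, simp)
  have stab: "stabilizers_in G Z (topspace cantor_space) \<beta>"
  proof -
    have "closedin (subgroup_space G) Z"
      using assms(3) unfolding uniformly_recurrent_subgroup_def by blast
    then have "closedin cantor_space {z \<in> topspace cantor_space. stabilizer G \<beta> z \<in> Z}"
      by (rule closedin_continuous_map_preimage[OF stab_cont])
    then have closed: "closed {z. stabilizer G \<beta> z \<in> Z}"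
      by (simp add: cantor)
    have "stabilizer G \<beta> (F x w) \<in> Z" if x: "x \<in> space X" for x w
    proof -
      have "stabilizer G \<beta> (F x w) = stabilizer G \<alpha> x"
        unfolding stabilizer_def using F_stab x by blast
      then show ?thesis using assms(6) x by (simp add: stabilizers_in_def)
    qed
    then have "closure {F x w | x w. x \<in> space X} \<subseteq> {z. stabilizer G \<beta> z \<in> Z}"
      by (intro closure_minimal closed) blast
    then show ?thesis unfolding dense stabilizers_in_def by blast
  qed
  have "admits_invariant_probability G (borel_of cantor_space) \<beta>"
    unfolding borel_of_cantor_space admits_invariant_probability_def
  proof (intro exI conjI ballI)
    let ?f = "\<lambda>x. F x (\<lambda>_. False)"
    have f[measurable]: "?f \<in> \<mu> \<rightarrow>\<^sub>M borel"
      using F_meas measurable_cong_sets[OF \<mu>(1) refl] by blast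
    show "prob_space (distr \<mu> borel ?f)" by (rule \<mu>.prob_space_distr[OF f])
    show "sets (distr \<mu> borel ?f) = sets borel" by simp
    fix g assume g: "g \<in> carrier G"
    have [measurable]: "\<beta> g \<in> borel_measurable borel"
      by (rule borel_measurable_continuous_onI[OF cont[OF g]])
    have \<alpha>g: "\<alpha> g \<in> \<mu> \<rightarrow>\<^sub>M X"
      using \<alpha>_meas[OF g] measurable_cong_sets[OF \<mu>(1) refl] by blast
    have "distr (distr \<mu> borel ?f) borel (\<beta> g) = distr \<mu> borel (\<beta> g \<circ> ?f)"
      by (rule distr_distr) measurable
    also have "\<dots> = distr \<mu> borel (?f \<circ> \<alpha> g)"
      using F_equiv[OF g] sets_eq_imp_space_eq[OF \<mu>(1)] by (intro distr_cong) auto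
    also have "\<dots> = distr (distr \<mu> X (\<alpha> g)) borel ?f"
      by (rule distr_distr[symmetric, OF F_meas \<alpha>g])
    also have "\<dots> = distr \<mu> borel ?f" by (simp only: \<mu>(2)[OF g])
    finally show "distr (distr \<mu> borel ?f) borel (\<beta> g) = distr \<mu> borel ?f" .
  qed
  moreover have "stabilizer G \<beta> ` topspace cantor_space = Z"
    by (rule stabilizer_image_eq_urs[OF assms(3) _ _ _ stab_cont stab])
       (simp_all add: cantor \<beta> compact_space_def compact_cantor_space)
  ultimately show ?thesis using action stab_cont stab by blast
qed

end
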